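(* Consider the disturbance-free closed loop $x(k+1)=f(x(k),u(k),\mathbf{0}_m)$, $k\in\mathbb{N}_0$, with $u(k)$ generated by Algorithm A$_1$ (described in the context), under the Markovian processor model described in the context (with transition matrix $Q=(q_{ij})$, conditional probabilities $p_{l|\varsigma}$, and $\hat p_0=\max_{\varsigma\in\{1,\dots,G\}}p_{0|\varsigma}$). Suppose that: (1) there exist $\varphi_1,\varphi_2\in\mathscr{K}_\infty$, $V\colon\mathbb{R}^n\to\mathbb{R}_{\ge 0}$, $\kappa\colon\mathbb{R}^n\to\mathbb{R}^p$ and $\rho\in[0,1)$ such that for all $x\in\mathbb{R}^n$, $\varphi_1(|x|)\le V(x)\le\varphi_2(|x|)$ and $V(f(x,\kappa(x),\mathbf{0}_m))\le\rho V(x)$; (2) there exists $\alpha\in[1,1/\hat p_0)$ such that $V(f(x,\mathbf{0}_p,\mathbf{0}_m))\le\alpha V(x)$ for all $x\in\mathbb{R}^n$, and $\mathbf{E}\{\varphi_2(|x(0)|)\}<\infty$. Let $\mathbb{G}=\{\varsigma\in\{1,\dots,G\}: p_{0|\varsigma}<1\}$ and for $\varsigma\in\mathbb{G}$ put $$\Upsilon_\varsigma=\bar q_\varsigma(I-\rho\bar Q)^{-1}\Big(\rho I+\frac{\alpha-\rho}{1-p_{0|\varsigma}}(I-\alpha\bar Q)^{-1}\sum_{l=1}^{\Lambda}p_{l|\varsigma}(\rho\bar Q)^l\Big)\bar p,$$ where $\bar q_\varsigma=[q_{\varsigma1}\ \cdots\ q_{\varsigma G}]$, $\bar Q=\mathrm{diag}(p_{0|1},\dots,p_{0|G})\,Q$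 and $\bar p=[1-p_{0|1}\ \cdots\ 1-p_{0|G}]^T$. If $\Upsilon_\varsigma<1$ for all $\varsigma\in\mathbb{G}$, then the closed loop with state trajectory $\{x(k)\}_{k\in\mathbb{N}_0}$ is stochastically stable.
   Context: Notation: $\mathbb{N}=\{1,2,\dots\}$, $\mathbb{N}_0=\mathbb{N}\cup\{0\}$; $\mathbf{0}_q$ is the zero vector in $\mathbb{R}^q$; $|\cdot|$ is the Euclidean norm; $1/\hat p_0=\infty$ if $\hat p_0=0$. A function $\varphi\colon\mathbb{R}_{\ge0}\to\mathbb{R}_{\ge0}$ is in $\mathscr{K}_\infty$ if it is continuous, zero at zero, strictly increasing and unbounded. Plant: $f\colon\mathbb{R}^n\times\mathbb{R}^p\times\mathbb{R}^m\to\mathbb{R}^n$ with $f(\mathbf{0}_n,\mathbf{0}_p,\mathbf{0}_m)=\mathbf{0}_n$; the initial state $x(0)$ is random. Stochastic stability: a system with state trajectory $\{x(k)\}_{k\in\mathbb{N}_0}$ is stochastically stable if $\sum_{k=0}^\infty\mathbf{E}\{\varphi(|x(k)|)\}<\infty$ for some $\varphi\in\mathscr{K}_\infty$. Algorithm A$_1$: $\Lambda\in\mathbb{N}$ is the buffer size, and $N(k)\in\{0,1,\dots,\Lambda\}$ is the random number of tentative controls that the processor can compute at step $k$. The tentative controls are computed by a fixed rule $\mu\colon\mathbb{R}^n\to\mathbb{R}^p$ satisfying $V(f(\chi,\mu(\chi),\mathbf{0}_m))\le\rho V(\chi)$ for all $\chi$ (for example $\mu=\kappa$): if $N(k)\ge1$,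 put $\chi_1=x(k)$ and, for $j=1,\dots,N(k)$, $u_j(k)=\mu(\chi_j)$, $\chi_{j+1}=f(\chi_j,u_j(k),\mathbf{0}_m)$. The buffer $b(k)=(b_1(k),\dots,b_\Lambda(k))$, with $b_j(k)\in\mathbb{R}^p$, is initialized by $b(-1)=0$ and obeys: if $N(k)=0$, $b(k)=(b_2(k-1),\dots,b_\Lambda(k-1),\mathbf{0}_p)$; if $N(k)\ge1$, $b(k)=(u_1(k),\dots,u_{N(k)}(k),\mathbf{0}_p,\dots,\mathbf{0}_p)$. The plant input is $u(k)=b_1(k)$. Markovian processor model: the processor state $\{g(k)\}_{k\in\mathbb{N}_0}$ is an irreducible aperiodic Markov chain on $\{1,\dots,G\}$, $G\in\mathbb{N}$, with transition matrix $Q=(q_{ij})$, $q_{ij}=\Pr\{g(k+1)=j\mid g(k)=i\}$. Given the processor states, the $N(k)$ are conditionally independent with $\Pr\{N(k)=l\mid g(k)=\varsigma\}=p_{l|\varsigma}$ for $l\in\{0,\dots,\Lambda\}$, $\varsigma\in\{1,\dots,G\}$. Standing conventions: it is assumed that $N(0)>0$ (probabilities and expectations are understood conditionally on this event); $x(0)$ is independent of $\{(g(k),N(k))\}$; and $f,V,\kappa,\mu$ are Borel measurable. *)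

theory Defs
  imports "HOL-Probability.Probability"
begin

definition class_K_infinity :: "(real \<Rightarrow> real) set" where
  "class_K_infinity =
     {\<phi>. continuous_on {0..} \<phi> \<and> \<phi> 0 = 0 \<and> strict_mono_on {0..} \<phi> \<and> \<not> bdd_above (\<phi> ` {0..})}"

text \<open>The library's \<open>indep_var\<close> requires both random variables to have the same value type;
  this is its characterization \<open>indep_var_eq\<close> for two different value types.\<close>

definition independent_rvs ::
    "'w measure \<Rightarrow> 'a measure \<Rightarrow> ('w \<Rightarrow> 'a) \<Rightarrow> 'b measure \<Rightarrow> ('w \<Rightarrow> 'b) \<Rightarrow> bool" where
  "independent_rvs M S X T Y \<longleftrightarrow>
     X \<in> M \<rightarrow>\<^sub>M S \<and> Y \<in> M \<rightarrow>\<^sub>M T \<and>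
     prob_space.indep_set M
       (sigma_sets (space M) {X -` A \<inter> space M | A. A \<in> sets S})
       (sigma_sets (space M) {Y -` A \<inter> space M | A. A \<in> sets T})"

definition stochastically_stable ::
    "'w measure \<Rightarrow> (nat \<Rightarrow> 'w \<Rightarrow> 'b::real_normed_vector) \<Rightarrow> bool" where
  "stochastically_stable M x \<longleftrightarrow>
     (\<exists>\<phi>\<in>class_K_infinity. (\<Sum>k. \<integral>\<^sup>+\<omega>. ennreal (\<phi> (norm (x k \<omega>))) \<partial>M) < \<infinity>)"

fun tentative_controls ::
    "((real^'n) \<times> (real^'p) \<times> (real^'m) \<Rightarrow> real^'n) \<Rightarrow> (real^'n \<Rightarrow> real^'p) \<Rightarrow> nat \<Rightarrow> real^'n
      \<Rightarrow> (real^'p) list" where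
  "tentative_controls f \<mu> 0 \<xi> = []"
| "tentative_controls f \<mu> (Suc j) \<xi> = \<mu> \<xi> # tentative_controls f \<mu> j (f (\<xi>, \<mu> \<xi>, 0))"

definition buffer_update ::
    "((real^'n) \<times> (real^'p) \<times> (real^'m) \<Rightarrow> real^'n) \<Rightarrow> (real^'n \<Rightarrow> real^'p) \<Rightarrow> nat \<Rightarrow> nat \<Rightarrow> real^'n
      \<Rightarrow> (real^'p) list \<Rightarrow> (real^'p) list" where
  "buffer_update f \<mu> \<Lambda> N \<xi> b =
     (if N = 0 then tl b @ [0] else tentative_controls f \<mu> N \<xi> @ replicate (\<Lambda> - N) 0)"

text \<open>Sample paths of the controller. The buffer is a list of length \<open>\<Lambda>\<close>, so its first entry
  is its head; the initial buffer, at time \<open>-1\<close>, is \<open>replicate \<Lambda> 0\<close>.\<close>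

definition algorithm_A1 ::
    "((real^'n) \<times> (real^'p) \<times> (real^'m) \<Rightarrow> real^'n) \<Rightarrow> (real^'n \<Rightarrow> real^'p) \<Rightarrow> nat \<Rightarrow> (nat \<Rightarrow> nat)
      \<Rightarrow> (nat \<Rightarrow> real^'n) \<Rightarrow> (nat \<Rightarrow> (real^'p) list) \<Rightarrow> (nat \<Rightarrow> real^'p) \<Rightarrow> bool" where
  "algorithm_A1 f \<mu> \<Lambda> N x b u \<longleftrightarrow>
     b 0 = buffer_update f \<mu> \<Lambda> (N 0) (x 0) (replicate \<Lambda> 0) \<and>
     (\<forall>k. b (Suc k) = buffer_update f \<mu> \<Lambda> (N (Suc k)) (x (Suc k)) (b k)) \<and>
     (\<forall>k. u k = hd (b k))"

text \<open>The type class power operation on \<open>real^'s^'s\<close> would be componentwise.\<close>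

primrec matrix_power :: "real^'s^'s \<Rightarrow> nat \<Rightarrow> real^'s^'s" where
  "matrix_power A 0 = mat 1"
| "matrix_power A (Suc n) = A ** matrix_power A n"

definition stochastic_matrix :: "real^'s^'s \<Rightarrow> bool" where
  "stochastic_matrix Q \<longleftrightarrow> (\<forall>i j. 0 \<le> Q $ i $ j) \<and> (\<forall>i. (\<Sum>j\<in>UNIV. Q $ i $ j) = 1)"

definition irreducible_chain :: "real^'s^'s \<Rightarrow> bool" where
  "irreducible_chain Q \<longleftrightarrow> (\<forall>i j. \<exists>n. matrix_power Q n $ i $ j > 0)"

definition aperiodic_chain :: "real^'s^'s \<Rightarrow> bool" where
  "aperiodic_chain Q \<longleftrightarrow> (\<forall>i. Gcd {n. n > 0 \<and> matrix_power Q n $ i $ i > 0} = 1)"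

text \<open>Conditional probabilities are only constrained when the conditioning event has positive
  probability; the initial distribution is arbitrary.\<close>

definition markov_chain ::
    "'w measure \<Rightarrow> real^'s^'s \<Rightarrow> (nat \<Rightarrow> 'w \<Rightarrow> 's::finite) \<Rightarrow> bool" where
  "markov_chain M Q g \<longleftrightarrow>
     stochastic_matrix Q \<and>
     (\<forall>k. g k \<in> M \<rightarrow>\<^sub>M count_space UNIV) \<and>
     (\<forall>k s j. \<P>(\<omega> in M. \<forall>i\<le>k. g i \<omega> = s i) > 0 \<longrightarrow>
        \<P>(\<omega> in M. g (Suc k) \<omega> = j \<bar> \<forall>i\<le>k. g i \<omega> = s i) =
        \<P>(\<omega> in M. g (Suc k) \<omega> = j \<bar> g k \<omega> = s k)) \<and>
     (\<forall>k i j. \<P>(\<omega> in M. g k \<omega> = i) > 0 \<longrightarrow>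
        \<P>(\<omega> in M. g (Suc k) \<omega> = j \<bar> g k \<omega> = i) = Q $ i $ j)"

definition markovian_processor ::
    "'w measure \<Rightarrow> nat \<Rightarrow> real^'s^'s \<Rightarrow> (nat \<Rightarrow> 's \<Rightarrow> real) \<Rightarrow> (nat \<Rightarrow> 'w \<Rightarrow> 's::finite)
      \<Rightarrow> (nat \<Rightarrow> 'w \<Rightarrow> nat) \<Rightarrow> bool" where
  "markovian_processor M \<Lambda> Q p g N \<longleftrightarrow>
     markov_chain M Q g \<and> irreducible_chain Q \<and> aperiodic_chain Q \<and>
     (\<forall>s. (\<forall>l\<le>\<Lambda>. 0 \<le> p l s) \<and> (\<Sum>l\<le>\<Lambda>. p l s) = 1) \<and>
     (\<forall>k. N k \<in> M \<rightarrow>\<^sub>M count_space {..\<Lambda>}) \<and>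
     (\<forall>k s l. l \<le> \<Lambda> \<longrightarrow> \<P>(\<omega> in M. g k \<omega> = s) > 0 \<longrightarrow>
        \<P>(\<omega> in M. N k \<omega> = l \<bar> g k \<omega> = s) = p l s) \<and>
     (\<forall>k s l. (\<forall>i\<le>k. l i \<le> \<Lambda>) \<longrightarrow> \<P>(\<omega> in M. \<forall>i\<le>k. g i \<omega> = s i) > 0 \<longrightarrow>
        \<P>(\<omega> in M. (\<forall>i\<le>k. N i \<omega> = l i) \<bar> \<forall>i\<le>k. g i \<omega> = s i) = (\<Prod>i\<le>k. p (l i) (s i)))"

definition Q_bar :: "real^'s^'s \<Rightarrow> (nat \<Rightarrow> 's::finite \<Rightarrow> real) \<Rightarrow> real^'s^'s" where
  "Q_bar Q p = (\<chi> i j. if i = j then p 0 i else 0) ** Q"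

definition Upsilon ::
    "real \<Rightarrow> real \<Rightarrow> nat \<Rightarrow> real^'s^'s \<Rightarrow> (nat \<Rightarrow> 's::finite \<Rightarrow> real) \<Rightarrow> 's \<Rightarrow> real" where
  "Upsilon \<rho> \<alpha> \<Lambda> Q p s =
     row s Q \<bullet>
       ((matrix_inv (mat 1 - \<rho> *\<^sub>R Q_bar Q p) **
         (\<rho> *\<^sub>R mat 1 +
          ((\<alpha> - \<rho>) / (1 - p 0 s)) *\<^sub>R
            (matrix_inv (mat 1 - \<alpha> *\<^sub>R Q_bar Q p) **
             (\<Sum>l = 1..\<Lambda>. p l s *\<^sub>R matrix_power (\<rho> *\<^sub>R Q_bar Q p) l))))
        *v (\<chi> i. 1 - p 0 i))"

end

theory Submission
  imports Defs
begin

text \<open>The closed loop contracts \<open>V\<close> by \<open>\<rho>\<close> in a step for which a computed control is available, and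
  expands it by at most \<open>\<alpha>\<close> in a step with an empty buffer: without disturbances the states
  predicted by the controller are the true ones, so a buffered control is the control \<open>\<mu>\<close> would
  choose now. Hence \<open>V (x k) \<le> W k * V (x 0)\<close>, where \<open>W k\<close> is a product of factors \<open>\<rho>\<close> and \<open>\<alpha>\<close> that
  depends only on \<open>N 0, \<dots>, N (k - 1)\<close> (\<open>algorithm_A1_gain\<close>). The initial state is independent of the
  processor, so the expectation factors, and everything reduces to \<open>(\<Sum>k. E (W k)) < \<infinity>\<close>.

  The factor of step \<open>k\<close> is a function of the number \<open>r\<close> of computed controls left in the buffer, and
  the pair of processor state and \<open>r\<close> is a Markov chain. So the sum is finite as soon
  as there is a function \<open>h \<ge> 0\<close> with \<open>1 + T h \<le> h\<close>, where \<open>T\<close> is the one-step expectation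
  weighted by the factor: then \<open>E (W k * h)\<close> decreases by at least \<open>E (W k)\<close> in each step
  (\<open>expected_gain_telescope\<close>).

  Such an \<open>h\<close> comes from a renewal argument over the times at which the buffer is refilled
  (\<open>drift_potential\<close>). Let \<open>z\<close> be the expected product of factors until the next refilling and \<open>b\<close> the
  expected sum of the partial products until then; both satisfy linear recursions in \<open>r\<close> governed
  by \<open>Q_bar\<close>, which are solvable with nonnegative solutions because \<open>\<alpha> * p 0 s < 1\<close>. The number
  \<open>Upsilon\<close> at \<open>s\<close> is the mean of \<open>z\<close> over the size of a refilling made in state \<open>s\<close>
  (\<open>Upsilon_eq_renewal\<close>). Since it is less than 1, \<open>h = b + C * z\<close> works for every constant \<open>C\<close> large
  enough that a refilling brings the mean of \<open>h\<close> back to at most \<open>C\<close>.\<close>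

section \<open>Resolvents of strictly substochastic matrices\<close>

text \<open>A minimum principle: at an index where \<open>y\<close> is minimal, the equation bounds the minimum below by
  a multiple of itself with factor less than 1, so the minimum is not negative.\<close>

lemma substochastic_resolvent_nonneg:
  fixes B :: "real^'s::finite^'s" and y w :: "real^'s"
  assumes nonneg: "\<And>i j. 0 \<le> B $ i $ j"
    and row_sum: "\<And>i. (\<Sum>j\<in>UNIV. B $ i $ j) < 1"
    and eq: "y = w + B *v y"
    and w: "\<And>i. 0 \<le> w $ i"
  shows "0 \<le> y $ i"
proof -
  define m where "m = Min (range (($) y))"
  have "m \<in> range (($) y)"
    unfolding m_def by (rule Min_in) auto
  then obtain a where a: "y $ a = m"
    by auto
  have le: "m \<le> y $ j" for j
    by (simp add: m_def)
  have "m = w $ a + (\<Sum>j\<in>UNIV. B $ a $ j * y $ j)"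
    using arg_cong[OF eq, of "\<lambda>v. v $ a"] a by (simp add: matrix_vector_mult_def)
  also have "\<dots> \<ge> 0 + (\<Sum>j\<in>UNIV. B $ a $ j * m)"
    by (intro add_mono w sum_mono mult_left_mono le nonneg)
  finally have "0 \<le> m * (1 - (\<Sum>j\<in>UNIV. B $ a $ j))"
    by (simp add: sum_distrib_left algebra_simps)
  then have "0 \<le> m"
    using row_sum[of a] by (simp add: zero_le_mult_iff)
  then show ?thesis
    using le[of i] by linarith
qed

text \<open>A vector in the kernel and its negative are both nonnegative by the minimum principle.\<close>

lemma substochastic_invertible:
  fixes B :: "real^'s::finite^'s"
  assumes nonneg: "\<And>i j. 0 \<le> B $ i $ j"
    and row_sum: "\<And>i. (\<Sum>j\<in>UNIV. B $ i $ j) < 1"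
  shows "invertible (mat 1 - B)"
proof -
  have "y = 0" if "(mat 1 - B) *v y = 0" for y
  proof -
    have eq: "y = 0 + B *v y"
      using that by (simp add: matrix_vector_mult_diff_rdistrib)
    have "- y = 0 + B *v (- y)"
      using eq by (metis add_0 matrix_vector_mult_scaleR scaleR_minus1_left)
    then have "0 \<le> (- y) $ i" for i
      by (rule substochastic_resolvent_nonneg[OF nonneg row_sum]) simp
    moreover have "0 \<le> y $ i" for i
      using eq by (rule substochastic_resolvent_nonneg[OF nonneg row_sum]) simp
    ultimately show ?thesis
      by (simp add: vec_eq_iff antisym)
  qed
  then show ?thesis
    by (simp add: invertible_left_inverse matrix_left_invertible_ker)
qed

lemma matrix_inv_mult:
  fixes A :: "real^'s::finite^'s"
  assumes "invertible A"
  shows matrix_inv_mult_left: "matrix_inv A ** A = mat 1"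
    and matrix_inv_mult_right: "A ** matrix_inv A = mat 1"
  using someI_ex[OF assms[unfolded invertible_def]] by (simp_all add: matrix_inv_def)

section \<open>Expected factors between two refillings of the buffer\<close>

text \<open>Let a step with \<open>r\<close> buffered controls carry the factor \<open>\<alpha>\<close> if \<open>r = 0\<close> and \<open>\<rho>\<close> otherwise, and let
  \<open>A = Q_bar Q p\<close>. For \<open>w = 1 - p 0\<close>, the product of row \<open>s\<close> of \<open>Q\<close> with this vector is the expected
  product of the factors from a time with processor state \<open>s\<close> and \<open>r\<close> buffered controls until the next
  refilling. For \<open>w = p 0\<close> it is the expected sum of the products up to each later time before that
  refilling. The buffer stays empty once \<open>r = 0\<close>, so there the vector is a fixed point, which
  the inverse matrix solves for.\<close>

primrec renewal_vector :: "real \<Rightarrow> real \<Rightarrow> real^'s^'s \<Rightarrow> real^'s \<Rightarrow> nat \<Rightarrow> real^'s::finite" where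
  "renewal_vector \<rho> \<alpha> A w 0 = \<alpha> *\<^sub>R (matrix_inv (mat 1 - \<alpha> *\<^sub>R A) *v w)"
| "renewal_vector \<rho> \<alpha> A w (Suc r) = \<rho> *\<^sub>R (w + A *v renewal_vector \<rho> \<alpha> A w r)"

text \<open>One recursion for both cases of the definition: with truncated subtraction, \<open>r = 0\<close> refers back to
  itself.\<close>

lemma renewal_vector_step:
  assumes "invertible (mat 1 - \<alpha> *\<^sub>R A)"
  shows "renewal_vector \<rho> \<alpha> A w r =
           (if r = 0 then \<alpha> else \<rho>) *\<^sub>R (w + A *v renewal_vector \<rho> \<alpha> A w (r - 1))"
proof (cases r)
  case 0
  define y where "y = matrix_inv (mat 1 - \<alpha> *\<^sub>R A) *v w"
  have "(mat 1 - \<alpha> *\<^sub>R A) *v y = w"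
    by (simp add: y_def matrix_vector_mul_assoc matrix_inv_mult_right[OF assms])
  then have "y = w + A *v (\<alpha> *\<^sub>R y)"
    by (simp add: matrix_vector_mult_diff_rdistrib matrix_vector_mult_scaleR
        scaleR_matrix_vector_assoc[symmetric] algebra_simps)
  then show ?thesis
    using 0 by (simp add: y_def[symmetric])
qed simp

lemma renewal_vector_nonneg:
  assumes A: "\<And>i j. 0 \<le> A $ i $ j" and row_sum: "\<And>i. \<alpha> * (\<Sum>j\<in>UNIV. A $ i $ j) < 1"
    and "0 \<le> \<rho>" "0 \<le> \<alpha>" and w: "\<And>i. 0 \<le> w $ i"
  shows "0 \<le> renewal_vector \<rho> \<alpha> A w r $ i"
proof (induction r arbitrary: i)
  case 0
  have B: "\<And>i j. 0 \<le> (\<alpha> *\<^sub>R A) $ i $ j" "\<And>i. (\<Sum>j\<in>UNIV. (\<alpha> *\<^sub>R A) $ i $ j) < 1"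
    using A row_sum \<open>0 \<le> \<alpha>\<close> by (simp_all add: sum_distrib_left)
  define y where "y = matrix_inv (mat 1 - \<alpha> *\<^sub>R A) *v w"
  have "(mat 1 - \<alpha> *\<^sub>R A) *v y = w"
    using substochastic_invertible[OF B]
    by (simp add: y_def matrix_vector_mul_assoc matrix_inv_mult_right)
  then have "y = w + (\<alpha> *\<^sub>R A) *v y"
    by (simp add: matrix_vector_mult_diff_rdistrib algebra_simps)
  then have "0 \<le> y $ i"
    using substochastic_resolvent_nonneg[OF B _ w] by blast
  then show ?case
    using \<open>0 \<le> \<alpha>\<close> by (simp add: y_def)
next
  case (Suc r)
  then show ?case
    using A w \<open>0 \<le> \<rho>\<close>
    by (auto simp: matrix_vector_mult_def intro!: mult_nonneg_nonneg add_nonneg_nonneg sum_nonneg)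
qed

text \<open>Multiplying the recursion by \<open>I - \<rho> A\<close> makes its geometric part in \<open>\<rho>\<close> telescope; what remains is
  the tail in \<open>\<alpha>\<close>, to which each buffered control contributes a factor \<open>\<rho> A\<close>. This uses that \<open>A\<close> commutes
  with its resolvent.\<close>

lemma renewal_vector_closed_form:
  fixes A :: "real^'s::finite^'s"
  assumes inv_\<rho>: "invertible (mat 1 - \<rho> *\<^sub>R A)" and inv_\<alpha>: "invertible (mat 1 - \<alpha> *\<^sub>R A)"
  shows "renewal_vector \<rho> \<alpha> A w r = matrix_inv (mat 1 - \<rho> *\<^sub>R A) *v
           (\<rho> *\<^sub>R w + (\<alpha> - \<rho>) *\<^sub>R (matrix_inv (mat 1 - \<alpha> *\<^sub>R A) *v (matrix_power (\<rho> *\<^sub>R A) r *v w)))"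
proof -
  define S where "S = matrix_inv (mat 1 - \<alpha> *\<^sub>R A)"
  define z where "z = renewal_vector \<rho> \<alpha> A w"
  note mv = matrix_vector_mult_diff_rdistrib matrix_vector_mult_diff_distrib matrix_vector_right_distrib
    matrix_vector_mult_scaleR scaleR_matrix_vector_assoc[symmetric]
  have S: "S *v v - \<alpha> *\<^sub>R (A *v (S *v v)) = v" "S *v v - \<alpha> *\<^sub>R (S *v (A *v v)) = v" for v
    using arg_cong[OF matrix_inv_mult_right[OF inv_\<alpha>], of "\<lambda>B. B *v v"]
      arg_cong[OF matrix_inv_mult_left[OF inv_\<alpha>], of "\<lambda>B. B *v v"]
    by (simp_all add: S_def[symmetric] matrix_vector_mul_assoc[symmetric] mv)
  have commute: "A *v (S *v v) = S *v (A *v v)" for v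
  proof -
    have "S *v (A *v v) = S *v (A *v (S *v v - \<alpha> *\<^sub>R (A *v (S *v v))))"
      by (simp add: S)
    also have "\<dots> = S *v (A *v (S *v v)) - \<alpha> *\<^sub>R (S *v (A *v (A *v (S *v v))))"
      by (simp add: mv)
    also have "\<dots> = A *v (S *v v)"
      by (rule S)
    finally show ?thesis ..
  qed
  have key: "z r - \<rho> *\<^sub>R (A *v z r) = \<rho> *\<^sub>R w + (\<alpha> - \<rho>) *\<^sub>R (S *v (matrix_power (\<rho> *\<^sub>R A) r *v w))" for r
  proof (induction r)
    case 0
    have "z 0 - \<rho> *\<^sub>R (A *v z 0) = \<alpha> *\<^sub>R (S *v w) - \<rho> *\<^sub>R (\<alpha> *\<^sub>R (A *v (S *v w)))"
      by (simp add: z_def S_def mv)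
    also have "\<alpha> *\<^sub>R (A *v (S *v w)) = S *v w - w"
      using S(1)[of w] by (simp add: algebra_simps)
    finally show ?case
      by (simp add: algebra_simps)
  next
    case (Suc r)
    have "z (Suc r) - \<rho> *\<^sub>R (A *v z (Suc r)) =
            \<rho> *\<^sub>R w - \<rho> *\<^sub>R \<rho> *\<^sub>R (A *v w) + \<rho> *\<^sub>R (A *v (z r - \<rho> *\<^sub>R (A *v z r)))"
      by (simp add: z_def mv scaleR_diff_right scaleR_add_right)
    also have "\<dots> = \<rho> *\<^sub>R w + (\<alpha> - \<rho>) *\<^sub>R \<rho> *\<^sub>R (A *v (S *v (matrix_power (\<rho> *\<^sub>R A) r *v w)))"
      by (simp add: Suc.IH mv scaleR_add_right mult.commute)
    finally show ?case
      by (simp add: matrix_vector_mul_assoc[symmetric] mv commute)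
  qed
  have "z r = matrix_inv (mat 1 - \<rho> *\<^sub>R A) *v ((mat 1 - \<rho> *\<^sub>R A) *v z r)"
    by (simp add: matrix_vector_mul_assoc matrix_inv_mult_left[OF inv_\<rho>])
  also have "(mat 1 - \<rho> *\<^sub>R A) *v z r = z r - \<rho> *\<^sub>R (A *v z r)"
    by (simp add: mv)
  finally show ?thesis
    unfolding key by (simp add: z_def S_def)
qed

lemma matrix_vector_mult_sum:
  fixes B :: "'i \<Rightarrow> real^'s^'t"
  shows "finite I \<Longrightarrow> (\<Sum>i\<in>I. B i) *v v = (\<Sum>i\<in>I. B i *v v)"
  by (induction rule: finite_induct) (simp_all add: matrix_vector_mult_add_rdistrib)

lemma Q_bar_nth: "Q_bar Q p $ i $ j = p 0 i * Q $ i $ j"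
  by (simp add: Q_bar_def matrix_matrix_mult_def if_distrib[of "\<lambda>c. c * _"] cong: if_cong)

lemma Q_bar_mult_nth: "(Q_bar Q p *v v) $ i = p 0 i * (row i Q \<bullet> v)"
  by (simp add: matrix_vector_mult_def Q_bar_nth row_def inner_vec_def sum_distrib_left mult.assoc)

text \<open>\<open>Upsilon\<close> is affine in the matrix powers, and the probabilities \<open>p l s\<close> with \<open>l \<ge> 1\<close> sum to \<open>1 - p 0 s\<close>.
  So averaging the closed form over \<open>l\<close> gives the formula of \<open>Upsilon\<close>, which is thereby the mean
  gain from one refilling to the next.\<close>

lemma Upsilon_eq_renewal:
  fixes Q :: "real^'s::finite^'s"
  assumes inv: "invertible (mat 1 - \<rho> *\<^sub>R Q_bar Q p)" "invertible (mat 1 - \<alpha> *\<^sub>R Q_bar Q p)"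
    and total: "(\<Sum>l\<le>\<Lambda>. p l s) = 1" and "p 0 s < 1"
  shows "(1 - p 0 s) * Upsilon \<rho> \<alpha> \<Lambda> Q p s =
           (\<Sum>l=1..\<Lambda>. p l s * (row s Q \<bullet> renewal_vector \<rho> \<alpha> (Q_bar Q p) (\<chi> i. 1 - p 0 i) l))"
proof -
  define A where "A = Q_bar Q p"
  define w :: "real^'s" where "w = (\<chi> i. 1 - p 0 i)"
  define R where "R = matrix_inv (mat 1 - \<rho> *\<^sub>R A)"
  define S where "S = matrix_inv (mat 1 - \<alpha> *\<^sub>R A)"
  define X where "X = (\<Sum>l = 1..\<Lambda>. p l s *\<^sub>R (matrix_power (\<rho> *\<^sub>R A) l *v w))"
  have "(\<Sum>l\<le>\<Lambda>. p l s) = p 0 s + (\<Sum>l=1..\<Lambda>. p l s)"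
    by (simp add: atMost_atLeast0 sum.atLeast_Suc_atMost)
  then have rest: "(\<Sum>l=1..\<Lambda>. p l s) = 1 - p 0 s"
    using total by simp
  have weight: "(1 - p 0 s) *\<^sub>R (\<rho> *\<^sub>R w) = (\<Sum>l=1..\<Lambda>. p l s *\<^sub>R (\<rho> *\<^sub>R w))"
    by (simp only: scaleR_sum_left[symmetric] rest)
  note mv = matrix_vector_mult_add_rdistrib matrix_vector_right_distrib
    matrix_vector_mult_scaleR scaleR_matrix_vector_assoc[symmetric] matrix_vector_mul_assoc[symmetric]
  have "Upsilon \<rho> \<alpha> \<Lambda> Q p s =
      row s Q \<bullet> (R *v (\<rho> *\<^sub>R w + ((\<alpha> - \<rho>) / (1 - p 0 s)) *\<^sub>R (S *v X)))"
    by (simp add: Upsilon_def A_def[symmetric] w_def[symmetric] R_def[symmetric] S_def[symmetric]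
        X_def mv matrix_vector_mult_sum)
  then have "(1 - p 0 s) * Upsilon \<rho> \<alpha> \<Lambda> Q p s =
      row s Q \<bullet> (R *v ((1 - p 0 s) *\<^sub>R (\<rho> *\<^sub>R w + ((\<alpha> - \<rho>) / (1 - p 0 s)) *\<^sub>R (S *v X))))"
    by (simp add: mv)
  also have "(1 - p 0 s) *\<^sub>R (\<rho> *\<^sub>R w + ((\<alpha> - \<rho>) / (1 - p 0 s)) *\<^sub>R (S *v X)) =
      (\<Sum>l=1..\<Lambda>. p l s *\<^sub>R (\<rho> *\<^sub>R w)) + (\<alpha> - \<rho>) *\<^sub>R (S *v X)"
    unfolding scaleR_add_right weight using \<open>p 0 s < 1\<close> by simp
  also have "S *v X = (\<Sum>l=1..\<Lambda>. p l s *\<^sub>R (S *v (matrix_power (\<rho> *\<^sub>R A) l *v w)))"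
    by (simp add: X_def linear_sum[OF matrix_vector_mul_linear] mv)
  also have "(\<Sum>l=1..\<Lambda>. p l s *\<^sub>R (\<rho> *\<^sub>R w)) + (\<alpha> - \<rho>) *\<^sub>R \<dots> =
      (\<Sum>l=1..\<Lambda>. p l s *\<^sub>R (\<rho> *\<^sub>R w + (\<alpha> - \<rho>) *\<^sub>R (S *v (matrix_power (\<rho> *\<^sub>R A) l *v w))))"
    by (simp add: sum.distrib[symmetric] scaleR_sum_right scaleR_add_right mult.commute)
  also have "row s Q \<bullet> (R *v \<dots>) = (\<Sum>l=1..\<Lambda>. p l s * (row s Q \<bullet> renewal_vector \<rho> \<alpha> A w l))"
    using renewal_vector_closed_form[of \<rho> A \<alpha> w] inv
    by (simp add: A_def R_def S_def linear_sum[OF matrix_vector_mul_linear] inner_sum_right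
        matrix_vector_mult_scaleR)
  finally show ?thesis
    by (simp add: A_def w_def)
qed

text \<open>The potential counts the gains expected until the next refilling and charges \<open>C\<close> times the gain with
  which that refilling is reached. Between refillings the inequality is an equality by the recursions;
  at a refilling it says that the charge \<open>C\<close> pays for a new cycle, whose mean cost is
  at most \<open>B + C * Upsilon\<close> if \<open>B\<close> bounds the gains expected within a cycle.\<close>

lemma drift_potential:
  fixes Q :: "real^'s::finite^'s"
  assumes Q: "stochastic_matrix Q"
    and p_nonneg: "\<And>l s. l \<le> \<Lambda> \<Longrightarrow> 0 \<le> p l s" and p_total: "\<And>s. (\<Sum>l\<le>\<Lambda>. p l s) = 1"
    and "0 \<le> \<rho>" "\<rho> < 1" "0 \<le> \<alpha>" and subcritical: "\<And>s. \<alpha> * p 0 s < 1"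
    and Upsilon: "\<And>s. p 0 s < 1 \<Longrightarrow> Upsilon \<rho> \<alpha> \<Lambda> Q p s < 1"
  obtains h :: "'s \<Rightarrow> nat \<Rightarrow> real" where "\<And>s r. 0 \<le> h s r"
    and "\<And>s r. 1 + (if r = 0 then \<alpha> else \<rho>) *
            (\<Sum>j\<in>UNIV. Q $ s $ j * (\<Sum>l\<le>\<Lambda>. p l j * h j (if l = 0 then r - 1 else l))) \<le> h s r"
proof -
  define A where "A = Q_bar Q p"
  define w :: "real^'s" where "w = (\<chi> i. 1 - p 0 i)"
  define d :: "real^'s" where "d = (\<chi> i. p 0 i)"
  define z where "z = renewal_vector \<rho> \<alpha> A w"
  define t where "t = renewal_vector \<rho> \<alpha> A d"
  define c where "c r = (if r = 0 then \<alpha> else \<rho>)" for r :: nat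
  have Q_nonneg: "0 \<le> Q $ i $ j" and Q_total: "(\<Sum>j\<in>UNIV. Q $ i $ j) = 1" for i j
    using Q by (auto simp: stochastic_matrix_def)
  have split: "(\<Sum>l\<le>\<Lambda>. F l) = F 0 + (\<Sum>l=1..\<Lambda>. F l)" for F :: "nat \<Rightarrow> real"
    by (simp add: atMost_atLeast0 sum.atLeast_Suc_atMost)
  have rest: "(\<Sum>l=1..\<Lambda>. p l s) = 1 - p 0 s" for s
    using p_total[of s] split[of "\<lambda>l. p l s"] by simp
  have p0: "0 \<le> p 0 s" for s
    by (simp add: p_nonneg)
  have p0_le: "p 0 s \<le> 1" for s
    using rest[of s] sum_nonneg[of "{1..\<Lambda>}" "\<lambda>l. p l s"] p_nonneg by fastforce
  have A_nonneg: "0 \<le> A $ i $ j" for i j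
    by (simp add: A_def Q_bar_nth p0 Q_nonneg)
  have A_row: "(\<Sum>j\<in>UNIV. A $ i $ j) = p 0 i" for i
    by (simp add: A_def Q_bar_nth sum_distrib_left[symmetric] Q_total)
  have rho_sub: "\<rho> * p 0 s < 1" for s
    using mult_left_le[OF p0_le \<open>0 \<le> \<rho>\<close>, of s] \<open>\<rho> < 1\<close> by linarith
  have inv: "invertible (mat 1 - \<rho> *\<^sub>R A)" "invertible (mat 1 - \<alpha> *\<^sub>R A)"
    by (rule substochastic_invertible;
        simp add: A_nonneg \<open>0 \<le> \<rho>\<close> \<open>0 \<le> \<alpha>\<close> sum_distrib_left[symmetric] A_row rho_sub subcritical)+
  have z_nonneg: "0 \<le> z r $ i" and t_nonneg: "0 \<le> t r $ i" for r i
    unfolding z_def t_def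
    by (rule renewal_vector_nonneg;
        simp add: A_nonneg A_row subcritical \<open>0 \<le> \<rho>\<close> \<open>0 \<le> \<alpha>\<close> w_def d_def p0 p0_le)+
  have z_step: "z r = c r *\<^sub>R (w + A *v z (r - 1))"
    and t_step: "t r = c r *\<^sub>R (d + A *v t (r - 1))" for r
    unfolding z_def t_def c_def by (rule renewal_vector_step[OF inv(2)])+
  have inner_row: "row i Q \<bullet> v = (\<Sum>j\<in>UNIV. Q $ i $ j * v $ j)" for i v
    by (simp add: inner_vec_def row_def)
  have row_nonneg: "0 \<le> row i Q \<bullet> v" if "\<And>j. 0 \<le> v $ j" for i v
    unfolding inner_row by (intro sum_nonneg mult_nonneg_nonneg Q_nonneg that)
  define b where "b = (\<lambda>j r. 1 + row j Q \<bullet> t r)"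
  have b_nonneg: "0 \<le> b j r" for j r
    using row_nonneg[OF t_nonneg, of j r] by (simp add: b_def)
  \<comment> \<open>A sum instead of a maximum, so that no range has to be shown nonempty.\<close>
  define B where "B = (\<Sum>j\<in>UNIV. \<Sum>l\<in>{1..\<Lambda>}. b j l)"
  have B: "b j l \<le> B" if "l \<in> {1..\<Lambda>}" for j l
  proof -
    have "b j l \<le> (\<Sum>l\<in>{1..\<Lambda>}. b j l)"
      using that b_nonneg by (intro member_le_sum) auto
    also have "\<dots> \<le> B"
      unfolding B_def
      by (rule member_le_sum[where f = "\<lambda>j. \<Sum>l\<in>{1..\<Lambda>}. b j l"]) (auto intro!: sum_nonneg b_nonneg)
    finally show ?thesis .
  qed
  have "0 \<le> B"
    unfolding B_def by (intro sum_nonneg b_nonneg)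
  define C where "C = (\<Sum>j\<in>{j. p 0 j < 1}. B / (1 - Upsilon \<rho> \<alpha> \<Lambda> Q p j))"
  have "0 \<le> C"
    unfolding C_def using \<open>0 \<le> B\<close> Upsilon by (intro sum_nonneg divide_nonneg_nonneg) (auto simp: less_imp_le)
  have C: "B + C * Upsilon \<rho> \<alpha> \<Lambda> Q p j \<le> C" if "p 0 j < 1" for j
  proof -
    have "B / (1 - Upsilon \<rho> \<alpha> \<Lambda> Q p j) \<le> C"
      unfolding C_def using that \<open>0 \<le> B\<close> Upsilon
      by (intro member_le_sum[where f = "\<lambda>j. B / (1 - Upsilon \<rho> \<alpha> \<Lambda> Q p j)"] divide_nonneg_nonneg)
        (auto simp: less_imp_le)
    then show ?thesis
      using Upsilon[OF that] by (simp add: field_simps)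
  qed
  define h where "h = (\<lambda>j r. b j r + C * (row j Q \<bullet> z r))"
  have redraw: "(\<Sum>l=1..\<Lambda>. p l j * h j l) \<le> C * (1 - p 0 j)" for j
  proof (cases "p 0 j < 1")
    case True
    have "(\<Sum>l=1..\<Lambda>. p l j * h j l) \<le> (\<Sum>l=1..\<Lambda>. p l j * B + C * (p l j * (row j Q \<bullet> z l)))"
      by (intro sum_mono) (auto simp: h_def distrib_left p_nonneg B mult_left_mono)
    also have "\<dots> = (1 - p 0 j) * B + C * ((1 - p 0 j) * Upsilon \<rho> \<alpha> \<Lambda> Q p j)"
      using Upsilon_eq_renewal[where Q = Q and p = p and s = j, OF _ _ p_total] inv True
      by (simp add: A_def z_def w_def sum.distrib sum_distrib_left[symmetric] sum_distrib_right[symmetric]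
          rest[simplified])
    also have "\<dots> = (1 - p 0 j) * (B + C * Upsilon \<rho> \<alpha> \<Lambda> Q p j)"
      by (simp add: algebra_simps)
    also have "\<dots> \<le> (1 - p 0 j) * C"
      using True C by (intro mult_left_mono) auto
    finally show ?thesis
      by (simp add: mult.commute)
  next
    \<comment> \<open>In a state with \<open>p 0 j = 1\<close> no refilling happens, and both sides vanish.\<close>
    case False
    then have "(\<Sum>l=1..\<Lambda>. p l j) = 0"
      using rest[of j] p0_le[of j] by simp
    then have "\<forall>l\<in>{1..\<Lambda>}. p l j = 0"
      by (subst (asm) sum_nonneg_eq_0_iff) (auto simp: p_nonneg)
    then show ?thesis
      using False p0_le[of j] by simp
  qed
  show thesis
  proof
    show "0 \<le> h s r" for s r
      using b_nonneg row_nonneg[OF z_nonneg] \<open>0 \<le> C\<close> by (auto simp: h_def)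
    fix s r
    have step: "c r * (\<Sum>l\<le>\<Lambda>. p l j * h j (if l = 0 then r - 1 else l)) \<le> (t r + C *\<^sub>R z r) $ j" for j
    proof -
      have "(\<Sum>l\<le>\<Lambda>. p l j * h j (if l = 0 then r - 1 else l)) =
          p 0 j * h j (r - 1) + (\<Sum>l=1..\<Lambda>. p l j * h j l)"
        unfolding split by (auto intro!: sum.cong)
      also have "\<dots> \<le> p 0 j * h j (r - 1) + C * (1 - p 0 j)"
        using redraw by simp
      finally have "c r * (\<Sum>l\<le>\<Lambda>. p l j * h j (if l = 0 then r - 1 else l)) \<le>
          c r * (p 0 j * h j (r - 1) + C * (1 - p 0 j))"
        using \<open>0 \<le> \<rho>\<close> \<open>0 \<le> \<alpha>\<close> by (intro mult_left_mono) (auto simp: c_def)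
      also have "\<dots> = (t r + C *\<^sub>R z r) $ j"
        by (subst z_step, subst t_step)
          (simp add: A_def Q_bar_mult_nth d_def w_def h_def b_def algebra_simps)
      finally show ?thesis .
    qed
    have "c r * (\<Sum>j\<in>UNIV. Q $ s $ j * (\<Sum>l\<le>\<Lambda>. p l j * h j (if l = 0 then r - 1 else l))) =
        (\<Sum>j\<in>UNIV. Q $ s $ j * (c r * (\<Sum>l\<le>\<Lambda>. p l j * h j (if l = 0 then r - 1 else l))))"
      by (simp add: sum_distrib_left mult.left_commute)
    also have "\<dots> \<le> (\<Sum>j\<in>UNIV. Q $ s $ j * (t r + C *\<^sub>R z r) $ j)"
      by (intro sum_mono mult_left_mono step Q_nonneg)
    also have "\<dots> = row s Q \<bullet> (t r + C *\<^sub>R z r)"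
      by (rule inner_row[symmetric])
    finally show "1 + (if r = 0 then \<alpha> else \<rho>) *
        (\<Sum>j\<in>UNIV. Q $ s $ j * (\<Sum>l\<le>\<Lambda>. p l j * h j (if l = 0 then r - 1 else l))) \<le> h s r"
      by (simp add: c_def h_def b_def inner_add_right)
  qed
qed


section \<open>Gain of the closed loop along a processor history\<close>

text \<open>Newest entry first, so that one more step of the processor is a \<open>Cons\<close>.\<close>

primrec history :: "(nat \<Rightarrow> 'a) \<Rightarrow> nat \<Rightarrow> 'a list" where
  "history a 0 = [a 0]"
| "history a (Suc k) = a (Suc k) # history a k"

lemma hd_history [simp]: "hd (history a k) = a k"
  by (cases k) simp_all

lemma history_eq_iff: "history a k = history a' k \<longleftrightarrow> (\<forall>i\<le>k. a i = a' i)"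
  by (induction k) (auto simp: le_Suc_eq)

lemma length_history [simp]: "length (history a k) = Suc k"
  by (induction k) simp_all

lemma set_history: "set (history a k) = a ` {..k}"
  by (induction k) (simp_all add: atMost_Suc)

lemma history_exists: "length y = Suc k \<Longrightarrow> \<exists>a. y = history a k"
proof (induction k arbitrary: y)
  case 0
  then obtain e where "y = [e]"
    by (auto simp: length_Suc_conv)
  then show ?case
    by (intro exI[of _ "\<lambda>_. e"]) simp
next
  case (Suc k)
  then obtain e y' where "y = e # y'" "length y' = Suc k"
    by (auto simp: length_Suc_conv)
  with Suc.IH obtain a where "y' = history a k"
    by blast
  then have "y = history (a(Suc k := e)) (Suc k)"
    using \<open>y = e # y'\<close> by (simp add: history_eq_iff)
  then show ?case
    by blast
qed

text \<open>The number of controls left in the buffer that come from the latest nonempty computation,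
  including the one applied now.\<close>

primrec buffered :: "('s \<times> nat) list \<Rightarrow> nat" where
  "buffered [] = 0"
| "buffered (e # y) = (if snd e = 0 then buffered y - 1 else snd e)"

text \<open>The entry of time \<open>i\<close> decides the step from \<open>x i\<close> to \<open>x (Suc i)\<close>. The gain of the history up to
  time \<open>i\<close> therefore compares \<open>V (x (Suc i))\<close> with \<open>V (x 0)\<close>, and \<open>x k\<close> needs the tail of the history up to
  time \<open>k\<close>.\<close>

primrec gain :: "real \<Rightarrow> real \<Rightarrow> ('s \<times> nat) list \<Rightarrow> real" where
  "gain \<rho> \<alpha> [] = 1"
| "gain \<rho> \<alpha> (e # y) = (if buffered (e # y) = 0 then \<alpha> else \<rho>) * gain \<rho> \<alpha> y"

lemma gain_nonneg: "0 \<le> \<rho> \<Longrightarrow> 0 \<le> \<alpha> \<Longrightarrow> 0 \<le> gain \<rho> \<alpha> y"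
  by (induction y) simp_all

lemma buffered_history_le: "(\<And>i. snd (a i) \<le> \<Lambda>) \<Longrightarrow> buffered (history a k) \<le> \<Lambda>"
  by (induction k) (auto intro: le_trans[OF diff_le_self])

definition planned_buffer ::
    "((real^'n) \<times> (real^'p) \<times> (real^'m) \<Rightarrow> real^'n) \<Rightarrow> (real^'n \<Rightarrow> real^'p) \<Rightarrow> nat \<Rightarrow> nat \<Rightarrow> real^'n
      \<Rightarrow> (real^'p) list" where
  "planned_buffer f \<mu> \<Lambda> r \<xi> = tentative_controls f \<mu> r \<xi> @ replicate (\<Lambda> - r) 0"

lemma hd_planned_buffer:
  "1 \<le> \<Lambda> \<Longrightarrow> hd (planned_buffer f \<mu> \<Lambda> r \<xi>) = (if r = 0 then 0 else \<mu> \<xi>)"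
  by (cases r; cases \<Lambda>) (simp_all add: planned_buffer_def)

text \<open>Without disturbances the plant reaches the state that the controller predicted, so the shifted
  plan is the plan computed afresh from the new state.\<close>

lemma shift_planned_buffer:
  assumes "1 \<le> \<Lambda>" "r \<le> \<Lambda>"
  shows "tl (planned_buffer f \<mu> \<Lambda> r \<xi>) @ [0] =
           planned_buffer f \<mu> \<Lambda> (r - 1) (f (\<xi>, hd (planned_buffer f \<mu> \<Lambda> r \<xi>), 0))"
proof (cases r)
  case 0
  then show ?thesis
    using assms by (cases \<Lambda>) (simp_all add: planned_buffer_def replicate_append_same)
next
  case (Suc r')
  then have "\<Lambda> - r' = Suc (\<Lambda> - r)"
    using assms by simp
  then show ?thesis
    using Suc by (simp add: planned_buffer_def replicate_append_same)
qed

text \<open>The buffer is at all times the plan for the current state, so its head is \<open>\<mu> (x k)\<close> as long as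
  computed controls remain, and zero afterwards.\<close>

lemma algorithm_A1_gain:
  assumes alg: "algorithm_A1 f \<mu> \<Lambda> (\<lambda>k. snd (a k)) x b u"
    and plant: "\<And>k. x (Suc k) = f (x k, u k, 0)"
    and "1 \<le> \<Lambda>" and bound: "\<And>k. snd (a k) \<le> \<Lambda>"
    and "0 \<le> \<rho>" "0 \<le> \<alpha>"
    and closed: "\<And>\<xi>. V (f (\<xi>, \<mu> \<xi>, 0)) \<le> \<rho> * V \<xi>"
    and "open": "\<And>\<xi>. V (f (\<xi>, 0, 0)) \<le> \<alpha> * V \<xi>"
  shows "V (x k) \<le> gain \<rho> \<alpha> (tl (history a k)) * V (x 0)"
proof -
  have b0: "b 0 = buffer_update f \<mu> \<Lambda> (snd (a 0)) (x 0) (replicate \<Lambda> 0)"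
    and b_Suc: "b (Suc k) = buffer_update f \<mu> \<Lambda> (snd (a (Suc k))) (x (Suc k)) (b k)"
    and u: "u k = hd (b k)" for k
    using alg by (auto simp: algorithm_A1_def)
  have buffered_le: "buffered (history a k) \<le> \<Lambda>" for k
    by (rule buffered_history_le[OF bound])
  have buffer: "b k = planned_buffer f \<mu> \<Lambda> (buffered (history a k)) (x k)" for k
  proof (induction k)
    case 0
    show ?case
      using shift_planned_buffer[of \<Lambda> 0 f \<mu>] \<open>1 \<le> \<Lambda>\<close>
      by (simp add: b0 buffer_update_def planned_buffer_def)
  next
    case (Suc k)
    then show ?case
      using shift_planned_buffer[OF \<open>1 \<le> \<Lambda>\<close> buffered_le, of f \<mu> k "x k"]
      by (simp add: b_Suc buffer_update_def plant u) (simp add: planned_buffer_def)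
  qed
  have step: "V (x (Suc k)) \<le> (if buffered (history a k) = 0 then \<alpha> else \<rho>) * V (x k)" for k
    using closed "open" by (simp add: plant u buffer hd_planned_buffer[OF \<open>1 \<le> \<Lambda>\<close>])
  show ?thesis
  proof (induction k)
    case (Suc k)
    have hist: "history a k = a k # tl (history a k)"
      by (cases k) simp_all
    have "V (x (Suc k)) \<le> (if buffered (history a k) = 0 then \<alpha> else \<rho>) *
        (gain \<rho> \<alpha> (tl (history a k)) * V (x 0))"
      using step[of k] Suc.IH \<open>0 \<le> \<rho>\<close> \<open>0 \<le> \<alpha>\<close>
      by (elim order_trans) (auto intro: mult_left_mono)
    also have "\<dots> = gain \<rho> \<alpha> (history a k) * V (x 0)"
      by (subst (3) hist, subst (1) hist) (simp add: mult.assoc)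
    finally show ?case
      by simp
  qed simp
qed

section \<open>Summability of the expected gain\<close>

text \<open>The finitely many values of \<open>history\<close> at time \<open>k\<close>, for controllers with buffer size \<open>\<Lambda>\<close>.\<close>

definition paths :: "nat \<Rightarrow> nat \<Rightarrow> ('s::finite \<times> nat) list set" where
  "paths \<Lambda> k = {y. set y \<subseteq> UNIV \<times> {..\<Lambda>} \<and> length y = Suc k}"

lemma finite_paths: "finite (paths \<Lambda> k :: ('s::finite \<times> nat) list set)"
  unfolding paths_def by (rule finite_lists_length_eq) simp

lemma paths_Suc: "paths \<Lambda> (Suc k) = (\<lambda>(y, e). e # y) ` (paths \<Lambda> k \<times> (UNIV \<times> {..\<Lambda>}))"
  by (force simp: paths_def image_iff length_Suc_conv)

lemma sum_paths_Suc:
  "(\<Sum>y\<in>paths \<Lambda> (Suc k). F y) = (\<Sum>y\<in>paths \<Lambda> k. \<Sum>j\<in>UNIV. \<Sum>l\<le>\<Lambda>. F ((j, l) # y))"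
proof -
  have "(\<Sum>y\<in>paths \<Lambda> (Suc k). F y) = (\<Sum>(y, e)\<in>paths \<Lambda> k \<times> (UNIV \<times> {..\<Lambda>}). F (e # y))"
    unfolding paths_Suc by (subst sum.reindex) (auto simp: inj_on_def case_prod_unfold)
  then show ?thesis
    by (simp add: sum.cartesian_product[symmetric] case_prod_unfold)
      (simp add: sum.cartesian_product case_prod_unfold)
qed

text \<open>Here \<open>\<pi> k\<close> is the law of the history at time \<open>k\<close>. The assumption \<open>drift\<close>, weighted with the gain and
  averaged over the histories, says that the expected weighted potential \<open>\<Phi>\<close> drops by at least the
  expected gain in each step. As \<open>\<Phi>\<close> is nonnegative, all partial sums are bounded by its initial value.\<close>

lemma expected_gain_telescope:
  fixes \<pi> :: "nat \<Rightarrow> ('s::finite \<times> nat) list \<Rightarrow> real" and h :: "'s \<Rightarrow> nat \<Rightarrow> real"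
  assumes law: "\<And>k y j l. y \<in> paths \<Lambda> k \<Longrightarrow> l \<le> \<Lambda> \<Longrightarrow>
        \<pi> (Suc k) ((j, l) # y) = \<pi> k y * Q $ fst (hd y) $ j * p l j"
    and \<pi>_nonneg: "\<And>k y. 0 \<le> \<pi> k y"
    and "0 \<le> \<rho>" "0 \<le> \<alpha>" and h_nonneg: "\<And>s r. 0 \<le> h s r"
    and drift: "\<And>s r. 1 + (if r = 0 then \<alpha> else \<rho>) *
            (\<Sum>j\<in>UNIV. Q $ s $ j * (\<Sum>l\<le>\<Lambda>. p l j * h j (if l = 0 then r - 1 else l))) \<le> h s r"
  shows "(\<Sum>k<K. \<Sum>y\<in>paths \<Lambda> k. \<pi> k y * gain \<rho> \<alpha> (tl y)) \<le>
           (\<Sum>y\<in>paths \<Lambda> 0. \<pi> 0 y * h (fst (hd y)) (buffered y))"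
proof -
  define E where "E k = (\<Sum>y\<in>paths \<Lambda> k. \<pi> k y * gain \<rho> \<alpha> (tl y))" for k
  define \<Phi> where "\<Phi> k = (\<Sum>y\<in>paths \<Lambda> k. \<pi> k y * gain \<rho> \<alpha> (tl y) * h (fst (hd y)) (buffered y))" for k
  have "0 \<le> \<Phi> k" for k
    unfolding \<Phi>_def using \<pi>_nonneg h_nonneg gain_nonneg[OF \<open>0 \<le> \<rho>\<close> \<open>0 \<le> \<alpha>\<close>]
    by (intro sum_nonneg mult_nonneg_nonneg) auto
  have step: "E k + \<Phi> (Suc k) \<le> \<Phi> k" for k
  proof -
    have "(\<Sum>j\<in>UNIV. \<Sum>l\<le>\<Lambda>. \<pi> (Suc k) ((j, l) # y) * gain \<rho> \<alpha> y * h j (buffered ((j, l) # y))) \<le>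
        \<pi> k y * gain \<rho> \<alpha> (tl y) * (h (fst (hd y)) (buffered y) - 1)" if y: "y \<in> paths \<Lambda> k" for y
    proof -
      obtain e y' where y_eq: "y = e # y'"
        using y by (cases y) (auto simp: paths_def)
      define c where "c = (if buffered y = 0 then \<alpha> else \<rho>)"
      have gain: "gain \<rho> \<alpha> y = c * gain \<rho> \<alpha> (tl y)"
        by (simp add: y_eq c_def)
      define T where "T = (\<Sum>j\<in>UNIV. Q $ fst e $ j * (\<Sum>l\<le>\<Lambda>. p l j * h j (if l = 0 then buffered y - 1 else l)))"
      have "(\<Sum>j\<in>UNIV. \<Sum>l\<le>\<Lambda>. \<pi> (Suc k) ((j, l) # y) * gain \<rho> \<alpha> y * h j (buffered ((j, l) # y))) =
          (\<Sum>j\<in>UNIV. \<Sum>l\<le>\<Lambda>. \<pi> k y * gain \<rho> \<alpha> (tl y) * (c *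
             (Q $ fst e $ j * (p l j * h j (if l = 0 then buffered y - 1 else l)))))"
        using law[OF y] by (intro sum.cong) (simp_all add: gain y_eq[THEN arg_cong[where f = hd]] mult_ac)
      also have "\<dots> = \<pi> k y * gain \<rho> \<alpha> (tl y) * (c * T)"
        by (simp add: T_def sum_distrib_left)
      also have "\<dots> \<le> \<pi> k y * gain \<rho> \<alpha> (tl y) * (h (fst e) (buffered y) - 1)"
        using drift[where r = "buffered y" and s = "fst e"] \<pi>_nonneg gain_nonneg[OF \<open>0 \<le> \<rho>\<close> \<open>0 \<le> \<alpha>\<close>]
        by (intro mult_left_mono mult_nonneg_nonneg) (simp_all add: T_def c_def)
      finally show ?thesis
        by (simp add: y_eq)
    qed
    then have "\<Phi> (Suc k) \<le> (\<Sum>y\<in>paths \<Lambda> k. \<pi> k y * gain \<rho> \<alpha> (tl y) * (h (fst (hd y)) (buffered y) - 1))"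
      unfolding \<Phi>_def sum_paths_Suc by (simp only: list.sel fst_conv) (rule sum_mono)
    also have "\<dots> = \<Phi> k - E k"
      by (simp add: \<Phi>_def E_def right_diff_distrib sum_subtractf)
    finally show ?thesis
      by simp
  qed
  have "(\<Sum>k<K. E k) + \<Phi> K \<le> \<Phi> 0"
  proof (induction K)
    case (Suc K)
    then show ?case
      using step[of K] by simp
  qed simp
  moreover have "\<Phi> 0 = (\<Sum>y\<in>paths \<Lambda> 0. \<pi> 0 y * h (fst (hd y)) (buffered y))"
    unfolding \<Phi>_def by (intro sum.cong) (auto simp: paths_def length_Suc_conv)
  ultimately show ?thesis
    using \<open>0 \<le> \<Phi> K\<close> by (simp add: E_def)
qed

section \<open>Law of the processor histories\<close>

lemma markovian_processor_measurable:
  assumes "markovian_processor M \<Lambda> Q p g N"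
  shows "g i \<in> M \<rightarrow>\<^sub>M count_space UNIV" "N i \<in> M \<rightarrow>\<^sub>M count_space UNIV"
proof -
  show "g i \<in> M \<rightarrow>\<^sub>M count_space UNIV"
    using assms by (simp add: markovian_processor_def markov_chain_def)
  have "N i \<in> M \<rightarrow>\<^sub>M count_space {..\<Lambda>}"
    using assms by (simp add: markovian_processor_def)
  then show "N i \<in> M \<rightarrow>\<^sub>M count_space UNIV"
    using measurable_compose[of "N i" M "count_space {..\<Lambda>}" "\<lambda>n. n" "count_space UNIV"] by simp
qed

text \<open>The processor law fixes conditional probabilities only for conditioning events of positive probability.
  On a null path of processor states both sides vanish, so the product formula holds for
  every path.\<close>

lemma markovian_processor_path_step:
  assumes "prob_space M" and proc: "markovian_processor M \<Lambda> Q p g N"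
    and bound: "\<And>i. i \<le> Suc k \<Longrightarrow> snd (a i) \<le> \<Lambda>"
  shows "\<P>(\<omega> in M. \<forall>i\<le>Suc k. (g i \<omega>, N i \<omega>) = a i) =
           \<P>(\<omega> in M. \<forall>i\<le>k. (g i \<omega>, N i \<omega>) = a i) * Q $ fst (a k) $ fst (a (Suc k)) *
             p (snd (a (Suc k))) (fst (a (Suc k)))"
proof -
  interpret prob_space M by fact
  define G where "G n = \<P>(\<omega> in M. \<forall>i\<le>n. g i \<omega> = fst (a i))" for n
  note [measurable] = markovian_processor_measurable[OF proc]
  have joint: "\<P>(\<omega> in M. \<forall>i\<le>n. (g i \<omega>, N i \<omega>) = a i) = G n * (\<Prod>i\<le>n. p (snd (a i)) (fst (a i)))"
    if "n \<le> Suc k" for n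
  proof -
    have eq: "(\<forall>i\<le>n. (g i \<omega>, N i \<omega>) = a i) \<longleftrightarrow>
        (\<forall>i\<le>n. N i \<omega> = snd (a i)) \<and> (\<forall>i\<le>n. g i \<omega> = fst (a i))" for \<omega>
      by (auto simp: prod_eq_iff)
    show ?thesis
    proof (cases "G n > 0")
      case True
      then have "\<P>(\<omega> in M. (\<forall>i\<le>n. N i \<omega> = snd (a i)) \<bar> \<forall>i\<le>n. g i \<omega> = fst (a i)) =
          (\<Prod>i\<le>n. p (snd (a i)) (fst (a i)))"
        using proc that bound by (simp add: markovian_processor_def G_def)
      then show ?thesis
        using True by (simp add: cond_prob_def eq G_def[symmetric] divide_eq_eq mult.commute)
    next
      case False
      then have "G n = 0"
        by (simp add: G_def antisym not_less)
      moreover have "\<P>(\<omega> in M. \<forall>i\<le>n. (g i \<omega>, N i \<omega>) = a i) \<le> G n"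
        unfolding G_def eq by (intro finite_measure_mono) auto
      ultimately show ?thesis
        by (simp add: antisym)
    qed
  qed
  have chain: "G (Suc k) = G k * Q $ fst (a k) $ fst (a (Suc k))"
  proof (cases "G k > 0")
    case True
    have "G k \<le> \<P>(\<omega> in M. g k \<omega> = fst (a k))"
      unfolding G_def by (intro finite_measure_mono) auto
    with True have "\<P>(\<omega> in M. g k \<omega> = fst (a k)) > 0"
      by simp
    then have "\<P>(\<omega> in M. g (Suc k) \<omega> = fst (a (Suc k)) \<bar> g k \<omega> = fst (a k)) = Q $ fst (a k) $ fst (a (Suc k))"
      using proc by (simp add: markovian_processor_def markov_chain_def)
    moreover have "\<P>(\<omega> in M. g (Suc k) \<omega> = fst (a (Suc k)) \<bar> \<forall>i\<le>k. g i \<omega> = fst (a i)) =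
        \<P>(\<omega> in M. g (Suc k) \<omega> = fst (a (Suc k)) \<bar> g k \<omega> = fst (a k))"
      using proc True[unfolded G_def]
      by (simp add: markovian_processor_def markov_chain_def)
    ultimately have "\<P>(\<omega> in M. g (Suc k) \<omega> = fst (a (Suc k)) \<bar> \<forall>i\<le>k. g i \<omega> = fst (a i)) =
        Q $ fst (a k) $ fst (a (Suc k))"
      by simp
    moreover have "G (Suc k) = \<P>(\<omega> in M. g (Suc k) \<omega> = fst (a (Suc k)) \<and> (\<forall>i\<le>k. g i \<omega> = fst (a i)))"
      unfolding G_def by (intro arg_cong[where f = "measure M"]) (auto simp: le_Suc_eq)
    ultimately show ?thesis
      using True by (simp add: cond_prob_def G_def[of k, symmetric] divide_eq_eq mult.commute)
  next
    case False
    then have "G k = 0"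
      by (simp add: G_def antisym not_less)
    moreover have "G (Suc k) \<le> G k"
      unfolding G_def by (intro finite_measure_mono) auto
    ultimately show ?thesis
      by (simp add: G_def antisym)
  qed
  show ?thesis
    by (simp add: joint chain)
qed

text \<open>A history determines \<open>N 0\<close>, so conditioning on \<open>N 0 > 0\<close> multiplies the probability of every
  history by a constant that is the same for all its continuations. The transition rule is
  therefore unchanged.\<close>

lemma conditioned_history_law:
  fixes g :: "nat \<Rightarrow> 'w \<Rightarrow> 's::finite"
  assumes "prob_space M" and proc: "markovian_processor M \<Lambda> Q p g N"
    and pos: "\<P>(\<omega> in M. N 0 \<omega> > 0) > 0"
    and M0: "M\<^sub>0 = uniform_measure M {\<omega> \<in> space M. N 0 \<omega> > 0}"
    and y: "y \<in> paths \<Lambda> k" and "l \<le> \<Lambda>"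
  shows "\<P>(\<omega> in M\<^sub>0. history (\<lambda>i. (g i \<omega>, N i \<omega>)) (Suc k) = (j, l) # y) =
           \<P>(\<omega> in M\<^sub>0. history (\<lambda>i. (g i \<omega>, N i \<omega>)) k = y) * Q $ fst (hd y) $ j * p l j"
proof -
  interpret prob_space M by fact
  define S where "S = {\<omega> \<in> space M. N 0 \<omega> > 0}"
  note [measurable] = markovian_processor_measurable[OF proc]
  have S [measurable]: "S \<in> sets M"
    unfolding S_def by measurable
  obtain a where a: "(j, l) # y = history a (Suc k)"
    using y history_exists[of "(j, l) # y" "Suc k"] by (auto simp: paths_def)
  then have a_eq: "y = history a k" "a (Suc k) = (j, l)"
    by simp_all
  have bound: "snd (a i) \<le> \<Lambda>" if "i \<le> Suc k" for i
    using y that a_eq \<open>l \<le> \<Lambda>\<close>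
    by (cases "i = Suc k") (auto simp: paths_def set_history image_subset_iff mem_Times_iff le_Suc_eq)
  define A where "A n = {\<omega> \<in> space M. \<forall>i\<le>n. (g i \<omega>, N i \<omega>) = a i}" for n
  have A [measurable]: "A n \<in> sets M" for n
  proof -
    have "A n = {\<omega> \<in> space M. \<forall>i\<le>n. g i \<omega> = fst (a i) \<and> N i \<omega> = snd (a i)}"
      by (auto simp: A_def prod_eq_iff)
    then show ?thesis
      by simp
  qed
  have cond: "measure M\<^sub>0 (A n) = (if snd (a 0) > 0 then prob (A n) / prob S else 0)" for n
  proof -
    have "S \<inter> A n = (if snd (a 0) > 0 then A n else {})"
      by (auto simp: S_def A_def prod_eq_iff)
    then show ?thesis
      using measure_uniform_measure[of M S "A n"] A pos
      by (simp add: M0 S_def emeasure_eq_measure)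
  qed
  have "prob (A (Suc k)) = prob (A k) * Q $ fst (a k) $ fst (a (Suc k)) * p (snd (a (Suc k))) (fst (a (Suc k)))"
    unfolding A_def by (rule markovian_processor_path_step[OF \<open>prob_space M\<close> proc bound])
  then have "measure M\<^sub>0 (A (Suc k)) = measure M\<^sub>0 (A k) * Q $ fst (a k) $ j * p l j"
    by (simp add: cond a_eq)
  then show ?thesis
    unfolding a unfolding a_eq history_eq_iff hd_history by (simp add: A_def M0)
qed

text \<open>Independence says that restricting the measure to an event of \<open>Y\<close> scales the law of \<open>X\<close> by the
  probability of that event.\<close>

lemma independent_rvs_nn_integral_indicator:
  assumes "prob_space M" and indep: "independent_rvs M S X T Y"
    and [measurable]: "\<psi> \<in> borel_measurable S" and B: "B \<in> sets T"
  shows "(\<integral>\<^sup>+\<omega>. \<psi> (X \<omega>) * indicator (Y -` B \<inter> space M) \<omega> \<partial>M) =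
           (\<integral>\<^sup>+\<omega>. \<psi> (X \<omega>) \<partial>M) * emeasure M (Y -` B \<inter> space M)"
proof -
  interpret prob_space M by fact
  have X [measurable]: "X \<in> M \<rightarrow>\<^sub>M S" and Y [measurable]: "Y \<in> M \<rightarrow>\<^sub>M T"
    and ind: "indep_set (sigma_sets (space M) {X -` A \<inter> space M | A. A \<in> sets S})
       (sigma_sets (space M) {Y -` A \<inter> space M | A. A \<in> sets T})"
    using indep by (simp_all add: independent_rvs_def)
  define E where "E = Y -` B \<inter> space M"
  have E [measurable]: "E \<in> sets M"
    unfolding E_def using B by measurable
  have "distr (density M (indicator E)) S X = scale_measure (emeasure M E) (distr M S X)"
  proof (rule measure_eqI)
    fix A assume "A \<in> sets (distr (density M (indicator E)) S X)"
    then have A: "A \<in> sets S" by simp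
    then have XA: "X -` A \<inter> space M \<in> sets M"
      by measurable
    have "prob ((X -` A \<inter> space M) \<inter> E) = prob (X -` A \<inter> space M) * prob E"
      using A B by (intro indep_setD[OF ind]) (auto simp: E_def)
    then have "emeasure M ((X -` A \<inter> space M) \<inter> E) = emeasure M (X -` A \<inter> space M) * emeasure M E"
      by (simp add: emeasure_eq_measure ennreal_mult)
    moreover have "emeasure (density M (indicator E)) (X -` A \<inter> space M) = emeasure M ((X -` A \<inter> space M) \<inter> E)"
      using emeasure_restricted[OF E XA] by (simp only: Int_commute)
    ultimately show "emeasure (distr (density M (indicator E)) S X) A =
        emeasure (scale_measure (emeasure M E) (distr M S X)) A"
      using A by (simp add: emeasure_distr mult.commute)
  qed simp
  then have "(\<integral>\<^sup>+v. \<psi> v \<partial>distr (density M (indicator E)) S X) =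
      (\<integral>\<^sup>+v. \<psi> v \<partial>scale_measure (emeasure M E) (distr M S X))"
    by simp
  then show ?thesis
    by (simp add: nn_integral_distr nn_integral_density nn_integral_scale_measure E_def[symmetric] mult.commute)
qed

section \<open>Stochastic stability\<close>

text \<open>The comparison function is \<open>\<phi>\<^sub>1\<close>. The expectation of \<open>V (x k)\<close> is split over the history of the processor:
  on each piece the gain is constant, and independence separates \<open>V (x 0)\<close> from the piece.\<close>

theorem theorem5:
  fixes M :: "'w measure"
    and f :: "(real^'n) \<times> (real^'p) \<times> (real^'m) \<Rightarrow> real^'n"
    and V :: "real^'n \<Rightarrow> real"
    and \<kappa> \<mu> :: "real^'n \<Rightarrow> real^'p"
    and \<phi>\<^sub>1 \<phi>\<^sub>2 :: "real \<Rightarrow> real"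
    and \<rho> \<alpha> :: real
    and \<Lambda> :: nat
    and Q :: "real^'s^'s"
    and p :: "nat \<Rightarrow> 's::finite \<Rightarrow> real"
    and g :: "nat \<Rightarrow> 'w \<Rightarrow> 's"
    and N :: "nat \<Rightarrow> 'w \<Rightarrow> nat"
    and x :: "nat \<Rightarrow> 'w \<Rightarrow> real^'n"
    and b :: "nat \<Rightarrow> 'w \<Rightarrow> (real^'p) list"
    and u :: "nat \<Rightarrow> 'w \<Rightarrow> real^'p"
  defines "p0_hat \<equiv> Max (range (p 0))"
    and "M\<^sub>0 \<equiv> uniform_measure M {\<omega> \<in> space M. N 0 \<omega> > 0}"
  assumes "prob_space M"
    and "\<Lambda> \<ge> 1"
    and "markovian_processor M \<Lambda> Q p g N"
    and "\<P>(\<omega> in M. N 0 \<omega> > 0) > 0"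
    and "f \<in> borel_measurable borel" "V \<in> borel_measurable borel"
        "\<kappa> \<in> borel_measurable borel" "\<mu> \<in> borel_measurable borel"
    and "f (0, 0, 0) = 0"
    and "independent_rvs M\<^sub>0 borel (x 0)
           (\<Pi>\<^sub>M k\<in>UNIV. count_space (UNIV \<times> {..\<Lambda>})) (\<lambda>\<omega> k. (g k \<omega>, N k \<omega>))"
    and "\<And>\<omega>. \<omega> \<in> space M \<Longrightarrow>
           algorithm_A1 f \<mu> \<Lambda> (\<lambda>k. N k \<omega>) (\<lambda>k. x k \<omega>) (\<lambda>k. b k \<omega>) (\<lambda>k. u k \<omega>)"
    and "\<And>\<omega> k. \<omega> \<in> space M \<Longrightarrow> x (Suc k) \<omega> = f (x k \<omega>, u k \<omega>, 0)"
    and "\<phi>\<^sub>1 \<in> class_K_infinity" "\<phi>\<^sub>2 \<in> class_K_infinity"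
    and "0 \<le> \<rho>" "\<rho> < 1"
    and "\<And>\<xi>. 0 \<le> V \<xi>"
    and "\<And>\<xi>. \<phi>\<^sub>1 (norm \<xi>) \<le> V \<xi> \<and> V \<xi> \<le> \<phi>\<^sub>2 (norm \<xi>)"
    and "\<And>\<xi>. V (f (\<xi>, \<kappa> \<xi>, 0)) \<le> \<rho> * V \<xi>"
    and "\<And>\<xi>. V (f (\<xi>, \<mu> \<xi>, 0)) \<le> \<rho> * V \<xi>"
    and "1 \<le> \<alpha>" "p0_hat \<noteq> 0 \<longrightarrow> \<alpha> < 1 / p0_hat"
    and "\<And>\<xi>. V (f (\<xi>, 0, 0)) \<le> \<alpha> * V \<xi>"
    and "(\<integral>\<^sup>+\<omega>. ennreal (\<phi>\<^sub>2 (norm (x 0 \<omega>))) \<partial>M\<^sub>0) < \<infinity>"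
    and "\<And>s. p 0 s < 1 \<Longrightarrow> Upsilon \<rho> \<alpha> \<Lambda> Q p s < 1"
  shows "stochastically_stable M\<^sub>0 x"
proof -
  interpret M: prob_space M by fact
  note proc = \<open>markovian_processor M \<Lambda> Q p g N\<close> and pos = \<open>\<P>(\<omega> in M. N 0 \<omega> > 0) > 0\<close>
    and V_measurable = \<open>V \<in> borel_measurable borel\<close>
    and indep = assms(12) and alg = assms(13) and plant = assms(14)
    and V_nonneg = assms(19) and V_bounds = assms(20)
    and closed_bound = assms(22) and open_bound = assms(25)
    and moment0 = assms(26) and Upsilon = assms(27)
  define a where "a \<omega> = (\<lambda>i. (g i \<omega>, N i \<omega>))" for \<omega>
  define \<pi> where "\<pi> k y = \<P>(\<omega> in M\<^sub>0. history (a \<omega>) k = y)" for k y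
  define v where "v = (\<integral>\<^sup>+\<omega>. ennreal (V (x 0 \<omega>)) \<partial>M\<^sub>0)"
  have [simp]: "space M\<^sub>0 = space M"
    by (simp add: M\<^sub>0_def)
  have "prob_space M\<^sub>0"
    unfolding M\<^sub>0_def using pos by (intro prob_space_uniform_measure) (auto simp: M.emeasure_eq_measure)
  interpret M0: prob_space M\<^sub>0 by fact
  have bound: "N k \<omega> \<le> \<Lambda>" if "\<omega> \<in> space M" for k \<omega>
  proof -
    have "N k \<in> M \<rightarrow>\<^sub>M count_space {..\<Lambda>}"
      using proc by (simp add: markovian_processor_def)
    then show ?thesis
      using that by (auto dest: measurable_space)
  qed
  have Q: "stochastic_matrix Q" and p_nonneg: "\<And>l s. l \<le> \<Lambda> \<Longrightarrow> 0 \<le> p l s"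
    and p_total: "\<And>s. (\<Sum>l\<le>\<Lambda>. p l s) = 1"
    using proc by (auto simp: markovian_processor_def markov_chain_def)
  have subcritical: "\<alpha> * p 0 s < 1" for s
  proof -
    have "p 0 s \<le> p0_hat"
      unfolding p0_hat_def by simp
    then have "\<alpha> * p 0 s \<le> \<alpha> * p0_hat"
      using \<open>1 \<le> \<alpha>\<close> by (intro mult_left_mono) auto
    also have "\<dots> < 1"
    proof (cases "p0_hat = 0")
      case False
      then have "0 < p0_hat"
        using \<open>p 0 s \<le> p0_hat\<close> p_nonneg[of 0 s] by linarith
      then show ?thesis
        using False \<open>p0_hat \<noteq> 0 \<longrightarrow> \<alpha> < 1 / p0_hat\<close> by (simp add: pos_less_divide_eq)
    qed simp
    finally show ?thesis .
  qed
  have "0 \<le> \<alpha>"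
    using \<open>1 \<le> \<alpha>\<close> by simp
  obtain h :: "'s \<Rightarrow> nat \<Rightarrow> real" where h: "\<And>s r. 0 \<le> h s r"
    and drift: "\<And>s r. 1 + (if r = 0 then \<alpha> else \<rho>) *
            (\<Sum>j\<in>UNIV. Q $ s $ j * (\<Sum>l\<le>\<Lambda>. p l j * h j (if l = 0 then r - 1 else l))) \<le> h s r"
    using drift_potential[OF Q p_nonneg p_total \<open>0 \<le> \<rho>\<close> \<open>\<rho> < 1\<close> \<open>0 \<le> \<alpha>\<close> subcritical Upsilon] by blast
  define H where "H = (\<Sum>y\<in>paths \<Lambda> 0. \<pi> 0 y * h (fst (hd y)) (buffered y))"
  have gain_sum: "(\<Sum>k<K. \<Sum>y\<in>paths \<Lambda> k. \<pi> k y * gain \<rho> \<alpha> (tl y)) \<le> H" for K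
    unfolding H_def
  proof (rule expected_gain_telescope[OF _ _ \<open>0 \<le> \<rho>\<close> \<open>0 \<le> \<alpha>\<close> h drift])
    show "\<pi> (Suc k) ((j, l) # y) = \<pi> k y * Q $ fst (hd y) $ j * p l j"
      if "y \<in> paths \<Lambda> k" "l \<le> \<Lambda>" for k y j l
      unfolding \<pi>_def a_def
      by (rule conditioned_history_law[OF \<open>prob_space M\<close> proc pos
            M\<^sub>0_def[THEN meta_eq_to_obj_eq] that])
  qed (simp add: \<pi>_def)
  have gain0: "0 \<le> gain \<rho> \<alpha> y" for y :: "('s \<times> nat) list"
    by (rule gain_nonneg[OF \<open>0 \<le> \<rho>\<close> \<open>0 \<le> \<alpha>\<close>])
  have moment: "(\<integral>\<^sup>+\<omega>. ennreal (\<phi>\<^sub>1 (norm (x k \<omega>))) \<partial>M\<^sub>0) \<le>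
      ennreal (\<Sum>y\<in>paths \<Lambda> k. \<pi> k y * gain \<rho> \<alpha> (tl y)) * v" for k
  proof -
    define E where "E y = {\<omega> \<in> space M. history (a \<omega>) k = y}" for y
    let ?T = "\<Pi>\<^sub>M k\<in>UNIV. count_space (UNIV \<times> {..\<Lambda>})"
    have Vm [measurable]: "(\<lambda>\<xi>. ennreal (V \<xi>)) \<in> borel_measurable borel"
      using V_measurable by measurable
    have x0 [measurable]: "x 0 \<in> M\<^sub>0 \<rightarrow>\<^sub>M borel" and am: "a \<in> M\<^sub>0 \<rightarrow>\<^sub>M ?T"
      using indep by (simp_all add: independent_rvs_def a_def[abs_def])
    \<comment> \<open>A history is a cylinder event of the processor path, hence independent of \<open>x 0\<close>.\<close>
    have E: "\<exists>B\<in>sets ?T. E y = a -` B \<inter> space M\<^sub>0" if y: "y \<in> paths \<Lambda> k" for y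
    proof -
      obtain c where c: "y = history c k"
        using y history_exists[of y k] by (auto simp: paths_def)
      have "c i \<in> UNIV \<times> {..\<Lambda>}" if "i \<le> k" for i
        using y that by (auto simp: paths_def c set_history)
      then have "(\<lambda>b. b i) -` {c i} \<inter> space ?T \<in> sets ?T" if "i \<le> k" for i
        using that by (intro measurable_sets[OF measurable_component_singleton]) auto
      then have "{b \<in> space ?T. b i = c i} \<in> sets ?T" if "i \<le> k" for i
        using that by (simp add: vimage_def Int_def conj_commute)
      then have "{b \<in> space ?T. \<forall>i\<in>{..k}. b i = c i} \<in> sets ?T"
        by (intro sets.sets_Collect_finite_All) auto
      moreover have "E y = a -` {b \<in> space ?T. \<forall>i\<in>{..k}. b i = c i} \<inter> space M\<^sub>0"
        using measurable_space[OF am] by (auto simp: E_def c history_eq_iff)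
      ultimately show ?thesis ..
    qed
    have E_sets: "E y \<in> sets M\<^sub>0" if "y \<in> paths \<Lambda> k" for y
      using E[OF that] measurable_sets[OF am] by auto
    have "(\<integral>\<^sup>+\<omega>. ennreal (\<phi>\<^sub>1 (norm (x k \<omega>))) \<partial>M\<^sub>0) \<le>
        (\<integral>\<^sup>+\<omega>. (\<Sum>y\<in>paths \<Lambda> k. ennreal (gain \<rho> \<alpha> (tl y)) * (ennreal (V (x 0 \<omega>)) * indicator (E y) \<omega>)) \<partial>M\<^sub>0)"
    proof (rule nn_integral_mono)
      fix \<omega> assume "\<omega> \<in> space M\<^sub>0"
      then have \<omega>: "\<omega> \<in> space M" by simp
      define y where "y = history (a \<omega>) k"
      have y: "y \<in> paths \<Lambda> k"
        using bound[OF \<omega>] by (auto simp: y_def paths_def set_history a_def)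
      have "\<phi>\<^sub>1 (norm (x k \<omega>)) \<le> V (x k \<omega>)"
        using V_bounds by blast
      also have "\<dots> \<le> gain \<rho> \<alpha> (tl y) * V (x 0 \<omega>)"
        unfolding y_def
      proof (rule algorithm_A1_gain)
        show "algorithm_A1 f \<mu> \<Lambda> (\<lambda>k. snd (a \<omega> k)) (\<lambda>k. x k \<omega>) (\<lambda>k. b k \<omega>) (\<lambda>k. u k \<omega>)"
          using alg[OF \<omega>] by (simp add: a_def)
      qed (use plant closed_bound open_bound \<open>1 \<le> \<Lambda>\<close> \<open>0 \<le> \<rho>\<close> \<omega> bound \<open>0 \<le> \<alpha>\<close> in \<open>auto simp: a_def\<close>)
      finally have "ennreal (\<phi>\<^sub>1 (norm (x k \<omega>))) \<le> ennreal (gain \<rho> \<alpha> (tl y)) * (ennreal (V (x 0 \<omega>)) * indicator (E y) \<omega>)"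
        using \<omega> gain0 V_nonneg by (simp add: E_def y_def ennreal_mult[symmetric] ennreal_leI)
      also have "\<dots> \<le> (\<Sum>y\<in>paths \<Lambda> k. ennreal (gain \<rho> \<alpha> (tl y)) * (ennreal (V (x 0 \<omega>)) * indicator (E y) \<omega>))"
        by (rule member_le_sum[OF y, where f = "\<lambda>y. ennreal (gain \<rho> \<alpha> (tl y)) * (ennreal (V (x 0 \<omega>)) * indicator (E y) \<omega>)"])
          (simp_all add: finite_paths)
      finally show "ennreal (\<phi>\<^sub>1 (norm (x k \<omega>))) \<le> \<dots>" .
    qed
    also have "\<dots> = (\<Sum>y\<in>paths \<Lambda> k. ennreal (gain \<rho> \<alpha> (tl y)) * (\<integral>\<^sup>+\<omega>. ennreal (V (x 0 \<omega>)) * indicator (E y) \<omega> \<partial>M\<^sub>0))"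
      using E_sets by (simp add: nn_integral_sum nn_integral_cmult)
    also have "\<dots> = (\<Sum>y\<in>paths \<Lambda> k. ennreal (\<pi> k y * gain \<rho> \<alpha> (tl y)) * v)"
    proof (intro sum.cong refl)
      fix y :: "('s \<times> nat) list" assume "y \<in> paths \<Lambda> k"
      then obtain B where "B \<in> sets ?T" "E y = a -` B \<inter> space M\<^sub>0"
        using E by blast
      then have "(\<integral>\<^sup>+\<omega>. ennreal (V (x 0 \<omega>)) * indicator (E y) \<omega> \<partial>M\<^sub>0) = v * emeasure M\<^sub>0 (E y)"
        using independent_rvs_nn_integral_indicator[OF \<open>prob_space M\<^sub>0\<close> indep Vm, of B]
        by (simp add: v_def a_def[abs_def])
      also have "emeasure M\<^sub>0 (E y) = ennreal (\<pi> k y)"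
        by (simp add: M0.emeasure_eq_measure E_def \<pi>_def)
      finally show "ennreal (gain \<rho> \<alpha> (tl y)) * (\<integral>\<^sup>+\<omega>. ennreal (V (x 0 \<omega>)) * indicator (E y) \<omega> \<partial>M\<^sub>0) =
          ennreal (\<pi> k y * gain \<rho> \<alpha> (tl y)) * v"
        using gain0 by (simp add: ennreal_mult \<pi>_def mult_ac)
    qed
    also have "\<dots> = ennreal (\<Sum>y\<in>paths \<Lambda> k. \<pi> k y * gain \<rho> \<alpha> (tl y)) * v"
      using gain0 by (simp add: sum_distrib_right[symmetric] sum_ennreal \<pi>_def)
    finally show ?thesis .
  qed
  have "v \<le> (\<integral>\<^sup>+\<omega>. ennreal (\<phi>\<^sub>2 (norm (x 0 \<omega>))) \<partial>M\<^sub>0)"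
    unfolding v_def using V_bounds by (intro nn_integral_mono ennreal_leI) blast
  then have "v < \<infinity>"
    using moment0 by simp
  have "(\<Sum>k. \<integral>\<^sup>+\<omega>. ennreal (\<phi>\<^sub>1 (norm (x k \<omega>))) \<partial>M\<^sub>0) \<le> ennreal H * v"
  proof (rule suminf_le_const[OF summableI])
    fix K
    have "(\<Sum>k<K. \<integral>\<^sup>+\<omega>. ennreal (\<phi>\<^sub>1 (norm (x k \<omega>))) \<partial>M\<^sub>0) \<le>
        (\<Sum>k<K. ennreal (\<Sum>y\<in>paths \<Lambda> k. \<pi> k y * gain \<rho> \<alpha> (tl y)) * v)"
      by (rule sum_mono) (rule moment)
    also have "\<dots> = ennreal (\<Sum>k<K. \<Sum>y\<in>paths \<Lambda> k. \<pi> k y * gain \<rho> \<alpha> (tl y)) * v"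
      using gain0 by (simp add: sum_distrib_right[symmetric] sum_ennreal sum_nonneg \<pi>_def)
    also have "\<dots> \<le> ennreal H * v"
      using gain_sum by (intro mult_right_mono ennreal_leI) auto
    finally show "(\<Sum>k<K. \<integral>\<^sup>+\<omega>. ennreal (\<phi>\<^sub>1 (norm (x k \<omega>))) \<partial>M\<^sub>0) \<le> ennreal H * v" .
  qed
  also have "\<dots> < \<infinity>"
    using \<open>v < \<infinity>\<close> by (simp add: ennreal_mult_less_top)
  finally show ?thesis
    using \<open>\<phi>\<^sub>1 \<in> class_K_infinity\<close> unfolding stochastically_stable_def by blast
qed

end
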